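(* Let $n\ge 1$, let $G\subset\mathbb{C}^n$ be a complete Reinhardt domain, and suppose that the $n$-variable power series $\sum_\alpha c_\alpha z^\alpha$ converges in $G$ and that $\left|\sum_\alpha c_\alpha z^\alpha\right|<1$ for all $z\in G$. Then $\sum_\alpha |c_\alpha z^\alpha|<1$ for all $z$ in the scaled domain $K_n\cdot G$, where $K_n$ is the $n$-dimensional Bohr radius for the unit polydisc.
   Context: Multi-index notation: $\alpha=(\alpha_1,\dots,\alpha_n)$ denotes an $n$-tuple of nonnegative integers, $z=(z_1,\dots,z_n)\in\mathbb{C}^n$, and $z^\alpha=z_1^{\alpha_1}z_2^{\alpha_2}\cdots z_n^{\alpha_n}$. An $n$-variable power series is a series $\sum_\alpha c_\alpha z^\alpha$ with complex coefficients $c_\alpha$, the sum being over all multi-indices $\alpha$. The unit polydisc is $\{z\in\mathbb{C}^n:\max_{1\le j\le n}|z_j|<1\}$. The $n$-dimensional Bohr radius $K_n$ is the largest number such that the following holds: whenever a power series $\sum_\alpha c_\alpha z^\alpha$ converges in the unit polydisc and satisfies $\left|\sum_\alpha c_\alpha z^\alpha\right|<1$ for all $z$ in the unit polydisc, then $\sum_\alpha |c_\alpha z^\alpha|<1$ for all $z$ with $\max_{1\le j\le n}|z_j|<K_n$. A complete Reinhardt domain in $\mathbb{C}^n$ is a domain that is a union of (open) polydiscs centered at the origin, i.e. of sets $\{z\in\mathbb{C}^n:|z_j|<r_j,\ 1\le j\le n\}$ with radii $r_j>0$ not necessarily equal to each other; $G$ is not assumed to be logarithmically convex. For a real number $t$,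 $t\cdot G=\{tz: z\in G\}$. *)

theory Defs
  imports "HOL-Analysis.Analysis"
begin

definition multi_power :: "complex ^ 'n \<Rightarrow> nat ^ 'n \<Rightarrow> complex" where
  "multi_power z \<alpha> = (\<Prod>j\<in>UNIV. (z $ j) ^ (\<alpha> $ j))"

text \<open>
  \<^term>\<open>polydisc (vec K)\<close> is the set of \<^term>\<open>z\<close> whose largest component modulus is below
  \<^term>\<open>K\<close>; it is empty for \<^term>\<open>K \<le> 0\<close>.
\<close>

definition polydisc :: "real ^ 'n \<Rightarrow> (complex ^ 'n) set" where
  "polydisc r = {z. \<forall>j. norm (z $ j) < r $ j}"

definition complete_reinhardt_domain :: "(complex ^ 'n) set \<Rightarrow> bool" where
  "complete_reinhardt_domain G \<longleftrightarrow>
     open G \<and> connected G \<and> G \<noteq> {} \<and>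
     (\<exists>R. (\<forall>r\<in>R. \<forall>j. 0 < r $ j) \<and> G = (\<Union>r\<in>R. polydisc r))"

text \<open>
  Multiple series are unordered sums over all multi-indices. Since \<^const>\<open>infsum\<close> is \<open>0\<close> for
  families that are not summable, convergence is always stated along with a bound on the sum.
\<close>

definition converges_bounded_on :: "(nat ^ 'n \<Rightarrow> complex) \<Rightarrow> (complex ^ 'n) set \<Rightarrow> bool" where
  "converges_bounded_on c G \<longleftrightarrow>
     (\<forall>z\<in>G. (\<lambda>\<alpha>. c \<alpha> * multi_power z \<alpha>) summable_on UNIV \<and>
            norm (\<Sum>\<^sub>\<infinity>\<alpha>. c \<alpha> * multi_power z \<alpha>) < 1)"

definition majorant_bounded_on :: "(nat ^ 'n \<Rightarrow> complex) \<Rightarrow> (complex ^ 'n) set \<Rightarrow> bool" where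
  "majorant_bounded_on c G \<longleftrightarrow>
     (\<forall>z\<in>G. (\<lambda>\<alpha>. norm (c \<alpha> * multi_power z \<alpha>)) summable_on UNIV \<and>
            (\<Sum>\<^sub>\<infinity>\<alpha>. norm (c \<alpha> * multi_power z \<alpha>)) < 1)"

text \<open>The dimension \<open>n\<close> enters as the cardinality of the finite index type.\<close>

definition bohr_radius :: "'n::finite itself \<Rightarrow> real" where
  "bohr_radius TYPE('n) =
     (GREATEST K. \<forall>c :: nat ^ 'n \<Rightarrow> complex.
        converges_bounded_on c (polydisc (vec 1)) \<longrightarrow> majorant_bounded_on c (polydisc (vec K)))"

end

theory Submission imports Defs begin

text \<open>
  The domain \<open>G\<close> is a union of polydiscs centred at the origin, so every point \<open>w\<close> of \<open>G\<close> lies in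
  a polydisc with radii \<open>r\<close> on which the series is bounded by \<open>1\<close>. The coordinatewise dilation by
  \<open>r\<close> maps the unit polydisc onto that polydisc and turns \<open>c \<alpha>\<close> into \<open>c \<alpha> r\<^sup>\<alpha>\<close>, without changing
  the modulus of any term at corresponding points. The defining property of the Bohr radius \<open>K\<close> for
  the new coefficients then bounds the majorant series of the old ones at \<open>K w\<close>.

  This uses that the Bohr radius itself has the Bohr property, that is, that the greatest such number
  exists (\<open>bohr_radius_works\<close>). The admissible numbers contain \<open>0\<close>, whose polydisc is
  empty, and are bounded by \<open>1\<close>, as a single coordinate function shows; their supremum is admissible because a
  point with all coordinates below the supremum has them all below some admissible number.

  This argument gives \<open>K \<ge> 0\<close>. In the case \<open>K = 0\<close> the polydisc of radius \<open>K\<close> is empty, so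
  its Bohr property says nothing about the origin, the only point of \<open>0 \<cdot> G\<close>. There only the
  constant term of the series survives, so the claim is the assumed bound on the sum itself
  (\<open>majorant_at_origin\<close>).
\<close>

lemma multi_power_mult:
  "multi_power (\<chi> j. a $ j * z $ j) \<alpha> = multi_power a \<alpha> * multi_power z \<alpha>"
  by (simp add: multi_power_def power_mult_distrib prod.distrib)

lemma multi_power_zero:
  assumes "\<alpha> \<noteq> 0"
  shows "multi_power 0 \<alpha> = 0"
proof -
  obtain j where "\<alpha> $ j \<noteq> 0"
    using assms by (auto simp: vec_eq_iff)
  then show ?thesis
    unfolding multi_power_def by (intro prod_zero) (auto intro!: bexI[of _ j])
qed

lemma multi_power_axis: "multi_power z (axis k 1) = z $ k"
proof -
  have "multi_power z (axis k 1) = (\<Prod>j\<in>UNIV. if j = k then z $ j else 1)"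
    unfolding multi_power_def by (intro prod.cong) (auto simp: axis_def)
  then show ?thesis
    by simp
qed

definition bohr_admissible :: "'n::finite itself \<Rightarrow> real \<Rightarrow> bool" where
  "bohr_admissible TYPE('n) K \<longleftrightarrow>
     (\<forall>c :: nat ^ 'n \<Rightarrow> complex.
        converges_bounded_on c (polydisc (vec 1)) \<longrightarrow> majorant_bounded_on c (polydisc (vec K)))"

lemma bohr_radius_eq_Greatest:
  "bohr_radius TYPE('n::finite) = Greatest (bohr_admissible TYPE('n))"
  by (simp add: bohr_radius_def bohr_admissible_def [abs_def])

text \<open>For an admissible \<open>K > 1\<close> the coordinate function would violate the majorant bound at the
  point with all coordinates \<open>1\<close>, which the polydisc of radius \<open>K\<close> contains.\<close>

lemma bohr_admissible_le_1:
  assumes "bohr_admissible TYPE('n::finite) K"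
  shows "K \<le> 1"
proof (rule ccontr)
  assume "\<not> K \<le> 1"
  define k :: 'n where "k = undefined"
  define c :: "nat ^ 'n \<Rightarrow> complex" where "c \<alpha> = (if \<alpha> = axis k 1 then 1 else 0)" for \<alpha>
  have coordinate: "((\<lambda>\<alpha>. c \<alpha> * multi_power z \<alpha>) has_sum z $ k) UNIV" for z
    by (rule has_sum_finite_neutralI[where B = "{axis k 1}"])
       (auto simp: c_def multi_power_axis simp del: One_nat_def)
  have "converges_bounded_on c (polydisc (vec 1))"
    unfolding converges_bounded_on_def polydisc_def
    by (auto simp: infsumI[OF coordinate] intro: has_sum_imp_summable[OF coordinate])
  then have "majorant_bounded_on c (polydisc (vec K))"
    using assms by (simp add: bohr_admissible_def)
  moreover have "(1 :: complex ^ 'n) \<in> polydisc (vec K)"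
    using \<open>\<not> K \<le> 1\<close> by (simp add: polydisc_def)
  ultimately have "(\<Sum>\<^sub>\<infinity>\<alpha>. norm (c \<alpha> * multi_power 1 \<alpha>)) < 1"
    by (auto simp: majorant_bounded_on_def)
  moreover have "(\<Sum>\<^sub>\<infinity>\<alpha>. norm (c \<alpha> * multi_power 1 \<alpha>)) = 1"
    by (intro infsumI has_sum_finite_neutralI[where B = "{axis k 1}"])
       (auto simp: c_def multi_power_axis simp del: One_nat_def)
  ultimately show False
    by simp
qed

lemma bohr_admissible_0: "bohr_admissible TYPE('n::finite) 0"
  by (auto simp: bohr_admissible_def majorant_bounded_on_def polydisc_def not_less)

lemma bohr_radius_works:
  shows "bohr_admissible TYPE('n::finite) (bohr_radius TYPE('n))"
    and "bohr_radius TYPE('n) \<ge> 0"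
proof -
  define S where "S = Collect (bohr_admissible TYPE('n))"
  have S: "0 \<in> S" "bdd_above S"
    using bohr_admissible_0 bohr_admissible_le_1 by (auto simp: S_def intro!: bdd_aboveI[where M = 1])
  have adm: "bohr_admissible TYPE('n) (Sup S)"
    unfolding bohr_admissible_def majorant_bounded_on_def
  proof (intro allI impI ballI)
    fix c :: "nat ^ 'n \<Rightarrow> complex" and z :: "complex ^ 'n"
    assume c: "converges_bounded_on c (polydisc (vec 1))" and z: "z \<in> polydisc (vec (Sup S))"
    have "Max (range (\<lambda>j. norm (z $ j))) < Sup S"
      using z by (auto simp: polydisc_def)
    then obtain K where K: "K \<in> S" "Max (range (\<lambda>j. norm (z $ j))) < K"
      using S by (metis less_cSup_iff empty_iff)
    then have "z \<in> polydisc (vec K)"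
      by (auto simp: polydisc_def)
    then show "(\<lambda>\<alpha>. norm (c \<alpha> * multi_power z \<alpha>)) summable_on UNIV \<and>
               (\<Sum>\<^sub>\<infinity>\<alpha>. norm (c \<alpha> * multi_power z \<alpha>)) < 1"
      using c K(1) by (auto simp: S_def bohr_admissible_def majorant_bounded_on_def)
  qed
  have "bohr_radius TYPE('n) = Sup S"
    unfolding bohr_radius_eq_Greatest
    by (rule Greatest_equality) (use adm S in \<open>auto simp: S_def intro: cSup_upper\<close>)
  then show "bohr_admissible TYPE('n) (bohr_radius TYPE('n))" "bohr_radius TYPE('n) \<ge> 0"
    using adm S by (auto intro: cSup_upper)
qed

lemma majorant_at_origin:
  fixes c :: "nat ^ 'n \<Rightarrow> complex"
  assumes "converges_bounded_on c G" and "0 \<in> G"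
  shows "majorant_bounded_on c {0}"
proof -
  have vanish: "c \<alpha> * multi_power 0 \<alpha> = 0" if "\<alpha> \<noteq> 0" for \<alpha>
    using that by (simp add: multi_power_zero)
  have "(\<Sum>\<^sub>\<infinity>\<alpha>. c \<alpha> * multi_power 0 \<alpha>) = c 0 * multi_power 0 (0 :: nat ^ 'n)"
    by (intro infsumI has_sum_finite_neutralI[where B = "{0}"]) (use vanish in auto)
  moreover have "((\<lambda>\<alpha>. norm (c \<alpha> * multi_power 0 \<alpha>)) has_sum norm (c 0 * multi_power 0 (0 :: nat ^ 'n))) UNIV"
    by (rule has_sum_finite_neutralI[where B = "{0}"]) (use vanish in auto)
  ultimately show ?thesis
    using assms
    by (auto simp: majorant_bounded_on_def converges_bounded_on_def infsumI
             intro: has_sum_imp_summable)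
qed

text \<open>Dilating the coordinates by \<open>r\<close> reduces a polydisc with arbitrary radii to the unit polydisc.\<close>

lemma majorant_bounded_on_scaled_polydisc:
  fixes c :: "nat ^ 'n \<Rightarrow> complex" and r :: "real ^ 'n"
  assumes adm: "bohr_admissible TYPE('n) K"
    and r: "\<And>j. r $ j > 0"
    and c: "converges_bounded_on c (polydisc r)"
  shows "majorant_bounded_on c (polydisc (K *\<^sub>R r))"
proof -
  define a :: "complex ^ 'n" where "a = (\<chi> j. of_real (r $ j))"
  define d where "d \<alpha> = c \<alpha> * multi_power a \<alpha>" for \<alpha>
  have d: "d \<alpha> * multi_power z \<alpha> = c \<alpha> * multi_power (\<chi> j. a $ j * z $ j) \<alpha>" for z \<alpha>
    by (simp add: d_def multi_power_mult mult.assoc)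
  have "(\<chi> j. a $ j * z $ j) \<in> polydisc r" if "z \<in> polydisc (vec 1)" for z
    using that r by (auto simp: polydisc_def a_def norm_mult abs_of_pos)
  then have "converges_bounded_on d (polydisc (vec 1))"
    using c by (auto simp: converges_bounded_on_def d)
  then have maj: "majorant_bounded_on d (polydisc (vec K))"
    using adm by (auto simp: bohr_admissible_def)
  show ?thesis
    unfolding majorant_bounded_on_def
  proof
    fix z :: "complex ^ 'n"
    assume z: "z \<in> polydisc (K *\<^sub>R r)"
    define u :: "complex ^ 'n" where "u = (\<chi> j. z $ j / a $ j)"
    have "u \<in> polydisc (vec K)"
      using z r by (auto simp: polydisc_def u_def a_def norm_divide abs_of_pos pos_divide_less_eq)
    moreover have "z = (\<chi> j. a $ j * u $ j)"
      using r by (auto simp: vec_eq_iff u_def a_def less_imp_neq[symmetric])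
    ultimately show "(\<lambda>\<alpha>. norm (c \<alpha> * multi_power z \<alpha>)) summable_on UNIV \<and>
                     (\<Sum>\<^sub>\<infinity>\<alpha>. norm (c \<alpha> * multi_power z \<alpha>)) < 1"
      using maj by (simp add: majorant_bounded_on_def flip: d)
  qed
qed

theorem theorem3:
  fixes G :: "(complex ^ 'n) set" and c :: "nat ^ 'n \<Rightarrow> complex"
  assumes "complete_reinhardt_domain G"
    and "\<forall>z\<in>G. (\<lambda>\<alpha>. c \<alpha> * multi_power z \<alpha>) summable_on UNIV"
    and "\<forall>z\<in>G. norm (\<Sum>\<^sub>\<infinity>\<alpha>. c \<alpha> * multi_power z \<alpha>) < 1"
  shows "\<forall>z \<in> (\<lambda>w. bohr_radius TYPE('n) *\<^sub>R w) ` G.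
           (\<lambda>\<alpha>. norm (c \<alpha> * multi_power z \<alpha>)) summable_on UNIV \<and>
           (\<Sum>\<^sub>\<infinity>\<alpha>. norm (c \<alpha> * multi_power z \<alpha>)) < 1"
proof
  fix z
  assume "z \<in> (\<lambda>w. bohr_radius TYPE('n) *\<^sub>R w) ` G"
  then obtain w where w: "w \<in> G" "z = bohr_radius TYPE('n) *\<^sub>R w"
    by auto
  obtain R where R: "\<forall>r\<in>R. \<forall>j. 0 < r $ j" and G: "G = (\<Union>r\<in>R. polydisc r)"
    using assms(1) by (auto simp: complete_reinhardt_domain_def)
  obtain r where r: "r \<in> R" "w \<in> polydisc r"
    using w(1) G by auto
  have pos: "r $ j > 0" for j
    using R r(1) by auto
  have c: "converges_bounded_on c (polydisc r)"
    using assms(2,3) r(1) G by (auto simp: converges_bounded_on_def)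
  show "(\<lambda>\<alpha>. norm (c \<alpha> * multi_power z \<alpha>)) summable_on UNIV \<and>
        (\<Sum>\<^sub>\<infinity>\<alpha>. norm (c \<alpha> * multi_power z \<alpha>)) < 1"
  proof (cases "bohr_radius TYPE('n) = 0")
    case True
    then have "z = 0"
      using w by simp
    moreover have "0 \<in> polydisc r"
      using pos by (simp add: polydisc_def)
    ultimately show ?thesis
      using majorant_at_origin[OF c] by (simp add: majorant_bounded_on_def)
  next
    case False
    then have "bohr_radius TYPE('n) > 0"
      using bohr_radius_works(2)[where 'n = 'n] by simp
    then have "z \<in> polydisc (bohr_radius TYPE('n) *\<^sub>R r)"
      using r(2) w(2) by (simp add: polydisc_def)
    then show ?thesis
      using majorant_bounded_on_scaled_polydisc[OF bohr_radius_works(1) pos c]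
      by (auto simp: majorant_bounded_on_def)
  qed
qed

end
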